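(* Let $(a_n)_{n\ge 1}$ be a sequence of real numbers with $a_n\ge 0$ such that the Dirichlet series $\sum_{n=1}^\infty a_n/n^z$ converges to $f(z)=f(x+iy)$ for all $z=x+iy$ with $x>1$. For positive integers $N$ put $s_N=\sum_{n\le N}a_n$. Then the sequence $\{s_N/N\}_{N\ge 1}$ is bounded if and only if the quotient $$q(x+iy)=\frac{f(x+iy)}{x+iy}\qquad(x>1),$$ regarded for each fixed $x>1$ as a tempered distribution in the variable $y\in\mathbb{R}$, converges in the sense of tempered distributions to a pseudomeasure (denoted $q(1+iy)$) as $x\searrow 1$.
   Context: Here $z=x+iy$ with $x,y$ real. A pseudomeasure on $\mathbb{R}$ is a tempered distribution that is the distributional Fourier transform $\hat H$ of a bounded measurable function $H$ on $\mathbb{R}$; the Fourier transform is normalized by $\hat H(y)=\int_{\mathbb{R}}H(t)e^{-iyt}\,dt$ for integrable $H$ and extended to tempered distributions in the usual way. Convergence in the sense of tempered distributions is convergence in the Schwartz space $\mathcal{S}'(\mathbb{R})$: $q(x+iy)\to q(1+iy)$ as $x\searrow 1$ means that $$\langle q(x+iy),\phi(y)\rangle=\int_{\mathbb{R}}q(x+iy)\phi(y)\,dy\;\to\;\langle q(1+iy),\phi(y)\rangle\quad\text{as } x\searrow 1$$ for every testing function $\phi\in\mathcal{S}(\mathbb{R})$ (rapidly decreasing $C^\infty$ functions). *)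

theory Defs
  imports "HOL-Analysis.Analysis"
begin

definition iterated_deriv :: "nat \<Rightarrow> (real \<Rightarrow> complex) \<Rightarrow> real \<Rightarrow> complex" where
  "iterated_deriv k \<phi> = ((\<lambda>g y. vector_derivative g (at y)) ^^ k) \<phi>"

definition schwartz :: "(real \<Rightarrow> complex) \<Rightarrow> bool" where
  "schwartz \<phi> \<longleftrightarrow>
     (\<forall>k y. iterated_deriv k \<phi> differentiable (at y)) \<and>
     (\<forall>j k. bounded (range (\<lambda>y. complex_of_real (y ^ j) * iterated_deriv k \<phi> y)))"

definition schwartz_seminorm :: "nat \<Rightarrow> nat \<Rightarrow> (real \<Rightarrow> complex) \<Rightarrow> real" where
  "schwartz_seminorm j k \<phi> = (SUP y. cmod (complex_of_real (y ^ j) * iterated_deriv k \<phi> y))"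

text \<open>
  Distributions are represented by functionals on all functions from the reals to the complex
  numbers, of which only the values at Schwartz functions matter. Continuity is with respect
  to the topology generated by the seminorms.
\<close>

definition tempered_distribution :: "((real \<Rightarrow> complex) \<Rightarrow> complex) \<Rightarrow> bool" where
  "tempered_distribution T \<longleftrightarrow>
     (\<forall>\<phi> \<psi>. schwartz \<phi> \<longrightarrow> schwartz \<psi> \<longrightarrow> T (\<lambda>y. \<phi> y + \<psi> y) = T \<phi> + T \<psi>) \<and>
     (\<forall>c \<phi>. schwartz \<phi> \<longrightarrow> T (\<lambda>y. c * \<phi> y) = c * T \<phi>) \<and>
     (\<forall>\<phi>. schwartz \<phi> \<longrightarrow> (\<forall>\<epsilon>>0. \<exists>\<delta>>0. \<exists>m. \<forall>\<psi>. schwartz \<psi> \<longrightarrow>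
        (\<forall>j\<le>m. \<forall>k\<le>m. schwartz_seminorm j k (\<lambda>y. \<psi> y - \<phi> y) < \<delta>) \<longrightarrow>
        cmod (T \<psi> - T \<phi>) < \<epsilon>))"

definition distribution_of_fun :: "(real \<Rightarrow> complex) \<Rightarrow> (real \<Rightarrow> complex) \<Rightarrow> complex" where
  "distribution_of_fun g \<phi> = (\<integral>y. g y * \<phi> y \<partial>lebesgue)"

definition fourier_transform :: "(real \<Rightarrow> complex) \<Rightarrow> real \<Rightarrow> complex" where
  "fourier_transform g y = (\<integral>t. g t * exp (- (\<i> * complex_of_real (y * t))) \<partial>lebesgue)"

text \<open>
  Extension of the Fourier transform to tempered distributions by duality; by Fubini's theorem
  the two agree for integrable functions.
\<close>

definition distribution_fourier ::
    "((real \<Rightarrow> complex) \<Rightarrow> complex) \<Rightarrow> (real \<Rightarrow> complex) \<Rightarrow> complex" where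
  "distribution_fourier T \<phi> = T (fourier_transform \<phi>)"

definition pseudomeasure :: "((real \<Rightarrow> complex) \<Rightarrow> complex) \<Rightarrow> bool" where
  "pseudomeasure T \<longleftrightarrow> tempered_distribution T \<and>
     (\<exists>H. H \<in> borel_measurable lebesgue \<and> bounded (range H) \<and>
          (\<forall>\<phi>. schwartz \<phi> \<longrightarrow> T \<phi> = distribution_fourier (distribution_of_fun H) \<phi>))"

definition tempered_tendsto ::
    "('i \<Rightarrow> (real \<Rightarrow> complex) \<Rightarrow> complex) \<Rightarrow> ((real \<Rightarrow> complex) \<Rightarrow> complex) \<Rightarrow> 'i filter \<Rightarrow> bool" where
  "tempered_tendsto S T F \<longleftrightarrow> (\<forall>\<phi>. schwartz \<phi> \<longrightarrow> ((\<lambda>i. S i \<phi>) \<longlongrightarrow> T \<phi>) F)"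

end

theory Submission
  imports Defs "HOL-Probability.Probability" "HOL-Real_Asymp.Real_Asymp"
begin

text \<open>
  Let \<open>A(t)\<close> be the sum of the coefficients \<open>a\<^sub>n\<close> with \<open>ln n < t\<close>. Then \<open>q(x + iy)\<close> is the Fourier
  transform of \<open>G\<^sub>x(t) = A(t) exp(-xt)\<close>, so pairing it with a test function \<open>\<phi>\<close> gives the integral of
  \<open>G\<^sub>x\<close> against the Fourier transform of \<open>\<phi>\<close>, and \<open>s\<^sub>N / N\<close> is bounded iff \<open>G\<^sub>1\<close> is. If \<open>G\<^sub>1\<close> is bounded,
  the limit exists by dominated convergence and is the Fourier transform of \<open>G\<^sub>1\<close>. Conversely,
  test with a modulated Gaussian whose transform is a positive Gaussian centred at \<open>u = ln N\<close>:
  the limit of the pairings is at most a constant independent of \<open>u\<close>, while monotonicity of \<open>A\<close> on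
  \<open>(u, u + 1]\<close> bounds the pairings below by a constant times \<open>s\<^sub>N exp(-x(u + 1))\<close>.
\<close>

section \<open>Schwartz functions and their Fourier transforms\<close>

lemma iterated_deriv_0 [simp]: "iterated_deriv 0 \<phi> = \<phi>"
  by (simp add: iterated_deriv_def)

lemma iterated_deriv_Suc:
  "iterated_deriv (Suc k) \<phi> = (\<lambda>y. vector_derivative (iterated_deriv k \<phi>) (at y))"
  by (simp add: iterated_deriv_def)

lemma iterated_deriv_add: "iterated_deriv j (iterated_deriv k \<phi>) = iterated_deriv (j + k) \<phi>"
  by (simp add: iterated_deriv_def funpow_add)

lemma schwartz_iterated_deriv: "schwartz \<phi> \<Longrightarrow> schwartz (iterated_deriv k \<phi>)"
  by (simp add: schwartz_def iterated_deriv_add)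

lemma schwartz_has_vector_derivative:
  assumes "schwartz \<phi>"
  shows "(iterated_deriv k \<phi> has_vector_derivative iterated_deriv (Suc k) \<phi> y) (at y)"
  using assms by (simp add: schwartz_def iterated_deriv_Suc vector_derivative_works)

lemma schwartz_continuous: "schwartz \<phi> \<Longrightarrow> continuous_on A (iterated_deriv k \<phi>)"
  by (meson schwartz_has_vector_derivative has_vector_derivative_continuous
      continuous_at_imp_continuous_on)

lemma schwartz_measurable: "schwartz \<phi> \<Longrightarrow> \<phi> \<in> borel_measurable borel"
  using schwartz_continuous[of \<phi> UNIV 0] by (simp add: borel_measurable_continuous_onI)

text \<open>The boundedness clause of \<open>schwartz\<close> makes the real-valued
  \<open>SUP\<close> a genuine least upper bound.\<close>

lemma schwartz_seminorm_upper:
  assumes "schwartz \<phi>"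
  shows "cmod (complex_of_real (y ^ j) * iterated_deriv k \<phi> y) \<le> schwartz_seminorm j k \<phi>"
proof -
  have "bounded (range (\<lambda>y. complex_of_real (y ^ j) * iterated_deriv k \<phi> y))"
    using assms by (simp add: schwartz_def)
  then have "bdd_above (range (\<lambda>y. cmod (complex_of_real (y ^ j) * iterated_deriv k \<phi> y)))"
    unfolding bounded_iff bdd_above_def by auto
  then show ?thesis
    unfolding schwartz_seminorm_def by (rule cSUP_upper[OF UNIV_I])
qed

text \<open>Adding the seminorms of weight 1 and of weight \<open>y^2\<close> produces the factor
  \<open>1 + y^2\<close>. The constant is kept as an explicit combination of seminorms because the
  continuity of a distribution must later be read off from it.\<close>

lemma schwartz_decay:
  assumes "schwartz \<phi>"
  shows "cmod (iterated_deriv k \<phi> y) \<le>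
    (schwartz_seminorm 0 k \<phi> + schwartz_seminorm 2 k \<phi>) * inverse (1 + y\<^sup>2)"
proof -
  have "(1 + y\<^sup>2) * cmod (iterated_deriv k \<phi> y) \<le> schwartz_seminorm 0 k \<phi> + schwartz_seminorm 2 k \<phi>"
    using schwartz_seminorm_upper[OF assms, of y 0 k] schwartz_seminorm_upper[OF assms, of y 2 k]
    by (simp add: norm_mult norm_power distrib_right)
  moreover have "1 + y\<^sup>2 > 0" by (simp add: add_pos_nonneg)
  ultimately show ?thesis by (simp add: field_simps)
qed

lemma
  shows integrable_inverse_1_plus_square_UNIV: "integrable lborel (\<lambda>y::real. inverse (1 + y\<^sup>2))"
    and integral_inverse_1_plus_square_UNIV: "(\<integral>y. inverse (1 + y\<^sup>2) \<partial>(lborel :: real measure)) = pi"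
  using integrable_inverse_1_plus_square LBINT_inverse_1_plus_square
  by (simp_all add: set_integrable_def interval_lebesgue_integral_def set_lebesgue_integral_def)

lemma schwartz_integrable:
  assumes "schwartz \<phi>"
  shows "integrable lborel \<phi>"
proof (rule Bochner_Integration.integrable_bound)
  show "integrable lborel (\<lambda>y. (schwartz_seminorm 0 0 \<phi> + schwartz_seminorm 2 0 \<phi>) * inverse (1 + y\<^sup>2))"
    by (intro integrable_mult_right integrable_inverse_1_plus_square_UNIV)
  show "AE y in lborel. cmod (\<phi> y) \<le>
      norm ((schwartz_seminorm 0 0 \<phi> + schwartz_seminorm 2 0 \<phi>) * inverse (1 + y\<^sup>2))"
    using schwartz_decay[OF assms, of 0] by (intro AE_I2) (fastforce intro: order_trans)
qed (use schwartz_measurable[OF assms] in simp)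

lemma schwartz_integral_norm_le:
  assumes "schwartz \<phi>"
  shows "(\<integral>y. cmod (\<phi> y) \<partial>lborel) \<le> pi * (schwartz_seminorm 0 0 \<phi> + schwartz_seminorm 2 0 \<phi>)"
proof -
  have "(\<integral>y. cmod (\<phi> y) \<partial>lborel) \<le>
      (\<integral>y. (schwartz_seminorm 0 0 \<phi> + schwartz_seminorm 2 0 \<phi>) * inverse (1 + y\<^sup>2) \<partial>lborel)"
    using schwartz_decay[OF assms, of 0] 
    by (intro integral_mono integrable_mult_right integrable_inverse_1_plus_square_UNIV
        integrable_norm schwartz_integrable[OF assms]) auto
  then show ?thesis
    by (simp add: integral_inverse_1_plus_square_UNIV mult.commute)
qed

lemma schwartz_seminorm_iterated_deriv:
  "schwartz_seminorm j k (iterated_deriv l \<phi>) = schwartz_seminorm j (k + l) \<phi>"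
  by (simp add: schwartz_seminorm_def iterated_deriv_add)

text \<open>Removes the boundary terms in integration by parts. The filter \<open>F\<close> is left
  open so that both ends of the line are covered.\<close>

lemma schwartz_tendsto_0:
  assumes "schwartz \<phi>" "F \<le> at_infinity"
  shows "(\<phi> \<longlongrightarrow> 0) F"
proof (rule Lim_null_comparison)
  show "\<forall>\<^sub>F y in F. cmod (\<phi> y) \<le> (schwartz_seminorm 0 0 \<phi> + schwartz_seminorm 2 0 \<phi>) * inverse (1 + y\<^sup>2)"
    using schwartz_decay[OF assms(1), of 0] by simp
  have "filterlim (\<lambda>y::real. 1 + y\<^sup>2) at_infinity at_infinity"
    by (intro tendsto_add_filterlim_at_infinity[OF tendsto_const] filterlim_power_at_infinity
        filterlim_ident) simp
  then have "((\<lambda>y::real. (schwartz_seminorm 0 0 \<phi> + schwartz_seminorm 2 0 \<phi>) * inverse (1 + y\<^sup>2)) \<longlongrightarrow> 0) at_infinity"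
    by (intro tendsto_mult_right_zero filterlim_compose[OF tendsto_inverse_0])
  then show "((\<lambda>y::real. (schwartz_seminorm 0 0 \<phi> + schwartz_seminorm 2 0 \<phi>) * inverse (1 + y\<^sup>2)) \<longlongrightarrow> 0) F"
    by (rule tendsto_mono[OF assms(2)])
qed

text \<open>Continuity of a tempered distribution is tested through seminorms of
  \<open>\<psi> - \<phi>\<close>, so the estimates have to apply to differences. Iterated
  derivatives are additive by induction on the order, each being differentiable.\<close>

lemma schwartz_diff:
  assumes "schwartz \<phi>" "schwartz \<psi>"
  shows "schwartz (\<lambda>y. \<phi> y - \<psi> y)"
proof -
  have eq: "iterated_deriv k (\<lambda>y. \<phi> y - \<psi> y) = (\<lambda>y. iterated_deriv k \<phi> y - iterated_deriv k \<psi> y)" for k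
  proof (induction k)
    case (Suc k)
    have "iterated_deriv k \<phi> differentiable at y" "iterated_deriv k \<psi> differentiable at y" for y
      using assms by (auto simp: schwartz_def)
    then show ?case by (simp add: iterated_deriv_Suc Suc)
  qed simp
  have "bounded (range (\<lambda>y. complex_of_real (y ^ j) * iterated_deriv k \<phi> y
      - complex_of_real (y ^ j) * iterated_deriv k \<psi> y))" for j k
    using assms by (intro bounded_minus_comp) (auto simp: schwartz_def)
  then show ?thesis
    using assms by (auto simp: schwartz_def eq right_diff_distrib)
qed

text \<open>The definition integrates over the completed measure. For a Borel integrand the value is
  the same over \<open>lborel\<close>, where Fubini's theorem on the product is available.\<close>

lemma fourier_transform_lborel:
  assumes [measurable]: "g \<in> borel_measurable borel"
  shows "fourier_transform g y = (\<integral>t. g t * exp (- (\<i> * complex_of_real (y * t))) \<partial>lborel)"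
  unfolding fourier_transform_def by (rule integral_completion) measurable

lemma fourier_transform_measurable [measurable]:
  assumes [measurable]: "g \<in> borel_measurable borel"
  shows "fourier_transform g \<in> borel_measurable borel"
  unfolding fourier_transform_lborel[OF assms, abs_def] by measurable

lemma integrable_mult_character:
  assumes "integrable lborel g"
  shows "integrable lborel (\<lambda>t. g t * exp (- (\<i> * complex_of_real (y * t))))"
proof (rule Bochner_Integration.integrable_bound[OF assms])
  show "(\<lambda>t. g t * exp (- (\<i> * complex_of_real (y * t)))) \<in> borel_measurable lborel"
    using borel_measurable_integrable[OF assms] by measurable
qed (simp add: norm_mult)

lemma cmod_fourier_transform_le:
  assumes "integrable lborel g"
  shows "cmod (fourier_transform g y) \<le> (\<integral>t. cmod (g t) \<partial>lborel)"
proof -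
  have "cmod (fourier_transform g y) \<le> (\<integral>t. cmod (g t * exp (- (\<i> * complex_of_real (y * t)))) \<partial>lborel)"
    using borel_measurable_integrable[OF assms]
    by (simp add: fourier_transform_lborel)
  then show ?thesis by (simp add: norm_mult)
qed

lemma fourier_transform_add:
  assumes "integrable lborel g" "integrable lborel h"
  shows "fourier_transform (\<lambda>t. g t + h t) y = fourier_transform g y + fourier_transform h y"
  using borel_measurable_integrable[OF assms(1)] borel_measurable_integrable[OF assms(2)]
    integrable_mult_character[OF assms(1)] integrable_mult_character[OF assms(2)]
  by (simp add: fourier_transform_lborel distrib_right)

lemma fourier_transform_diff:
  assumes "integrable lborel g" "integrable lborel h"
  shows "fourier_transform (\<lambda>t. g t - h t) y = fourier_transform g y - fourier_transform h y"
  using borel_measurable_integrable[OF assms(1)] borel_measurable_integrable[OF assms(2)]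
    integrable_mult_character[OF assms(1)] integrable_mult_character[OF assms(2)]
  by (simp add: fourier_transform_lborel left_diff_distrib)

lemma fourier_transform_cmult: "fourier_transform (\<lambda>t. c * g t) y = c * fourier_transform g y"
  by (simp add: fourier_transform_def mult.assoc)

section \<open>Derivatives and decay of the transform\<close>

lemma has_vector_derivative_exp_of_real:
  "((\<lambda>y. exp (c * complex_of_real y)) has_vector_derivative c * exp (c * of_real y)) (at y within A)"
  by (rule has_vector_derivative_real_field) (auto intro!: derivative_eq_intros)

text \<open>Integration by parts, carried out as the fundamental theorem of calculus on the whole
  line for \<open>F\<close>, the product of \<open>\<phi>\<close> with the character. Since
  \<open>F\<close> vanishes at both ends, its derivative \<open>f\<close> has integral 0, which is
  the claim.\<close>

lemma fourier_transform_deriv: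
  assumes "schwartz \<phi>"
  shows "fourier_transform (iterated_deriv 1 \<phi>) t = \<i> * of_real t * fourier_transform \<phi> t"
proof -
  define e where "e = (\<lambda>y. exp (- (\<i> * complex_of_real (t * y))))"
  define F where "F = (\<lambda>y. \<phi> y * e y)"
  define f where "f = (\<lambda>y. iterated_deriv 1 \<phi> y * e y - \<i> * of_real t * (\<phi> y * e y))"
  have \<phi>': "schwartz (iterated_deriv 1 \<phi>)"
    by (rule schwartz_iterated_deriv[OF assms])
  have e: "(e has_vector_derivative - \<i> * of_real t * e y) (at y)" for y
    using has_vector_derivative_exp_of_real[of "- \<i> * of_real t" y UNIV] by (simp add: e_def mult.assoc)
  have F: "(F has_vector_derivative f y) (at y)" for y
    unfolding F_def f_def
    using has_vector_derivative_mult[OF schwartz_has_vector_derivative[OF assms, of 0 y] e[of y]]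
    by (simp add: algebra_simps)
  have f: "isCont f y" for y
    unfolding f_def e_def
    using schwartz_continuous[OF assms, of UNIV 0] schwartz_continuous[OF assms, of UNIV 1]
    by (intro continuous_intros) (auto simp: continuous_on_eq_continuous_at)
  have i1: "integrable lborel (\<lambda>y. iterated_deriv 1 \<phi> y * e y)"
    unfolding e_def by (intro integrable_mult_character schwartz_integrable \<phi>')
  have i0: "integrable lborel (\<lambda>y. \<phi> y * e y)"
    unfolding e_def by (intro integrable_mult_character schwartz_integrable assms)
  have lim: "(F \<longlongrightarrow> 0) G" if "G \<le> at_infinity" for G
    using schwartz_tendsto_0[OF assms that] 
    by (rule Lim_null_comparison[rotated, OF tendsto_norm_zero]) (simp add: F_def e_def norm_mult)
  have "(LBINT y=-\<infinity>..\<infinity>. f y) = 0 - 0"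
  proof (rule interval_integral_FTC_integrable[OF _ F f])
    show "set_integrable lborel (einterval (-\<infinity>) \<infinity>) f"
      using i0 i1 by (simp add: set_integrable_def f_def)
  qed (auto simp: ereal_tendsto_simps intro!: lim at_top_le_at_infinity at_bot_le_at_infinity)
  then have "(\<integral>y. f y \<partial>lborel) = 0"
    by (simp add: interval_lebesgue_integral_def set_lebesgue_integral_def)
  then show ?thesis
    using i0 i1 schwartz_measurable[OF assms] schwartz_measurable[OF \<phi>']
    by (simp add: f_def fourier_transform_lborel e_def)
qed

text \<open>Two derivatives of \<open>\<phi>\<close> multiply the transform by \<open>- t^2\<close>.
  Hence \<open>(1 + t^2)\<close> times its modulus is the sum of the moduli of the transforms of
  \<open>\<phi>\<close> and of its second derivative, each at most an L1 norm.\<close>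

lemma fourier_transform_decay:
  assumes "schwartz \<phi>"
  shows "cmod (fourier_transform \<phi> t) \<le> pi * (schwartz_seminorm 0 0 \<phi> + schwartz_seminorm 2 0 \<phi>
    + schwartz_seminorm 0 2 \<phi> + schwartz_seminorm 2 2 \<phi>) * inverse (1 + t\<^sup>2)"
proof -
  have *: "cmod (fourier_transform (iterated_deriv k \<phi>) t)
      \<le> pi * (schwartz_seminorm 0 k \<phi> + schwartz_seminorm 2 k \<phi>)" for k
    using cmod_fourier_transform_le[OF schwartz_integrable, of "iterated_deriv k \<phi>"]
      schwartz_integral_norm_le[of "iterated_deriv k \<phi>"] schwartz_iterated_deriv[OF assms]
    by (fastforce simp: schwartz_seminorm_iterated_deriv intro: order_trans)
  have "iterated_deriv 2 \<phi> = iterated_deriv 1 (iterated_deriv 1 \<phi>)"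
    by (simp add: iterated_deriv_add numeral_2_eq_2)
  then have "fourier_transform (iterated_deriv 2 \<phi>) t = - of_real (t\<^sup>2) * fourier_transform \<phi> t"
    by (simp add: fourier_transform_deriv assms schwartz_iterated_deriv power2_eq_square
        mult_ac del: One_nat_def)
  then have "cmod (fourier_transform (iterated_deriv 2 \<phi>) t) = t\<^sup>2 * cmod (fourier_transform \<phi> t)"
    by (simp add: norm_mult norm_power)
  then have "(1 + t\<^sup>2) * cmod (fourier_transform \<phi> t) \<le> pi * (schwartz_seminorm 0 0 \<phi>
      + schwartz_seminorm 2 0 \<phi> + schwartz_seminorm 0 2 \<phi> + schwartz_seminorm 2 2 \<phi>)"
    using *[of 0] *[of 2] by (simp add: algebra_simps)
  moreover have "1 + t\<^sup>2 > 0" by (simp add: add_pos_nonneg)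
  ultimately show ?thesis by (simp add: field_simps)
qed

text \<open>Fubini for the kernel \<open>k\<close>: the character has modulus 1, so \<open>k\<close>
  is as integrable as the product of \<open>g\<close> and \<open>h\<close>. Its two iterated
  integrals are the two sides.\<close>

lemma integral_fourier_transform_mult:
  assumes g: "integrable lborel g" and h: "integrable lborel h"
  shows "(\<integral>y. fourier_transform g y * h y \<partial>lborel) = (\<integral>t. g t * fourier_transform h t \<partial>lborel)"
proof -
  have [measurable]: "g \<in> borel_measurable borel" "h \<in> borel_measurable borel"
    using g h by auto
  define k where "k = (\<lambda>(t, y). g t * h y * exp (- (\<i> * complex_of_real (y * t))))"
  have [measurable]: "k \<in> borel_measurable (lborel \<Otimes>\<^sub>M lborel)"
    unfolding k_def by measurable
  have "integrable (lborel \<Otimes>\<^sub>M lborel) k"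
  proof (rule lborel_pair.Fubini_integrable)
    show "integrable lborel (\<lambda>t. \<integral>y. norm (k (t, y)) \<partial>lborel)"
      using g by (simp add: k_def norm_mult mult.assoc)
    show "AE t in lborel. integrable lborel (\<lambda>y. k (t, y))"
      using integrable_mult_character[OF h] by (simp add: k_def mult.assoc mult.commute)
  qed measurable
  then have "(\<integral>y. (\<integral>t. k (t, y) \<partial>lborel) \<partial>lborel) = (\<integral>t. (\<integral>y. k (t, y) \<partial>lborel) \<partial>lborel)"
    using lborel_pair.Fubini_integral[of "\<lambda>t y. k (t, y)"] by simp
  moreover have "(\<integral>t. k (t, y) \<partial>lborel) = fourier_transform g y * h y" for y
  proof -
    have "k (t, y) = g t * exp (- (\<i> * complex_of_real (y * t))) * h y" for t
      by (simp add: k_def)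
    then show ?thesis by (simp add: fourier_transform_lborel)
  qed
  moreover have "(\<integral>y. k (t, y) \<partial>lborel) = g t * fourier_transform h t" for t
  proof -
    have "k (t, y) = g t * (h y * exp (- (\<i> * complex_of_real (t * y))))" for y
      by (simp add: k_def mult.commute)
    then show ?thesis by (simp add: fourier_transform_lborel)
  qed
  ultimately show ?thesis by simp
qed

section \<open>Pairings with transforms of test functions\<close>

lemma distribution_of_fun_lborel:
  assumes [measurable]: "g \<in> borel_measurable borel" "\<phi> \<in> borel_measurable borel"
  shows "distribution_of_fun g \<phi> = (\<integral>y. g y * \<phi> y \<partial>lborel)"
  unfolding distribution_of_fun_def by (rule integral_completion) measurable

lemma distribution_of_fourier_transform:
  assumes g: "integrable lborel g" and \<phi>: "schwartz \<phi>"
  shows "distribution_of_fun (fourier_transform g) \<phi> = (\<integral>t. g t * fourier_transform \<phi> t \<partial>lborel)"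
  using borel_measurable_integrable[OF g] schwartz_measurable[OF \<phi>]
  by (simp add: distribution_of_fun_lborel integral_fourier_transform_mult[OF g schwartz_integrable[OF \<phi>]])

lemma integrable_fourier_transform_schwartz:
  assumes "schwartz \<phi>"
  shows "integrable lborel (fourier_transform \<phi>)"
proof (rule Bochner_Integration.integrable_bound)
  let ?C = "pi * (schwartz_seminorm 0 0 \<phi> + schwartz_seminorm 2 0 \<phi>
    + schwartz_seminorm 0 2 \<phi> + schwartz_seminorm 2 2 \<phi>)"
  show "integrable lborel (\<lambda>t. ?C * inverse (1 + t\<^sup>2))"
    by (intro integrable_mult_right integrable_inverse_1_plus_square_UNIV)
  show "AE t in lborel. cmod (fourier_transform \<phi> t) \<le> norm (?C * inverse (1 + t\<^sup>2))"
    using fourier_transform_decay[OF assms] unfolding real_norm_def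
    by (intro AE_I2) (rule order_trans[OF _ abs_ge_self])
qed (use schwartz_measurable[OF assms] in simp)

text \<open>One factor \<open>pi\<close> comes from the decay estimate, the other from integrating
  \<open>inverse (1 + t^2)\<close> over the line.\<close>

lemma integral_norm_fourier_transform_le:
  assumes "schwartz \<phi>"
  shows "(\<integral>t. cmod (fourier_transform \<phi> t) \<partial>lborel) \<le> pi\<^sup>2 * (schwartz_seminorm 0 0 \<phi>
    + schwartz_seminorm 2 0 \<phi> + schwartz_seminorm 0 2 \<phi> + schwartz_seminorm 2 2 \<phi>)"
proof -
  let ?C = "pi * (schwartz_seminorm 0 0 \<phi> + schwartz_seminorm 2 0 \<phi>
    + schwartz_seminorm 0 2 \<phi> + schwartz_seminorm 2 2 \<phi>)"
  have "(\<integral>t. cmod (fourier_transform \<phi> t) \<partial>lborel) \<le> (\<integral>t. ?C * inverse (1 + t\<^sup>2) \<partial>lborel)"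
    by (intro integral_mono integrable_mult_right integrable_inverse_1_plus_square_UNIV
        integrable_norm integrable_fourier_transform_schwartz assms fourier_transform_decay)
  then show ?thesis
    by (simp only: integral_mult_right_zero integral_inverse_1_plus_square_UNIV)
       (simp add: power2_eq_square mult_ac)
qed

text \<open>A product that is not integrable has integral 0 by default, for which the bound is
  trivial. The measure is left general because the bound serves both \<open>lborel\<close> and its
  completion.\<close>

lemma cmod_integral_bounded_mult_le:
  fixes h k :: "real \<Rightarrow> complex"
  assumes "integrable M k" "\<And>t. cmod (h t) \<le> B"
  shows "cmod (\<integral>t. h t * k t \<partial>M) \<le> B * (\<integral>t. cmod (k t) \<partial>M)"
proof -
  have "B \<ge> 0" using assms(2)[of 0] norm_ge_zero order_trans by blast
  have "cmod (\<integral>t. h t * k t \<partial>M) \<le> (\<integral>t. cmod (h t * k t) \<partial>M)" by simp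
  also have "\<dots> \<le> (\<integral>t. B * cmod (k t) \<partial>M)"
    using assms \<open>B \<ge> 0\<close> by (intro integral_mono') (auto simp: norm_mult mult_right_mono)
  finally show ?thesis by simp
qed

text \<open>The functional is at most \<open>B\<close> times the L1 norm of the transform of the
  test function, and four Schwartz seminorms control that norm. Linearity then turns this bound into
  continuity.\<close>

lemma tempered_distribution_fourier_bounded:
  assumes [measurable]: "H \<in> borel_measurable borel" and B: "\<And>t. cmod (H t) \<le> B"
  shows "tempered_distribution (distribution_fourier (distribution_of_fun H))" (is "tempered_distribution ?T")
proof -
  have T: "?T \<phi> = (\<integral>t. H t * fourier_transform \<phi> t \<partial>lborel)" if "schwartz \<phi>" for \<phi>
    using schwartz_measurable[OF that]
    by (simp add: distribution_fourier_def distribution_of_fun_lborel)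
  have B0: "B \<ge> 0" using B[of 0] norm_ge_zero order_trans by blast
  have int: "integrable lborel (\<lambda>t. H t * fourier_transform \<phi> t)" if "schwartz \<phi>" for \<phi>
  proof (rule Bochner_Integration.integrable_bound)
    show "integrable lborel (\<lambda>t. B * cmod (fourier_transform \<phi> t))"
      using integrable_fourier_transform_schwartz[OF that] by simp
    show "AE t in lborel. cmod (H t * fourier_transform \<phi> t) \<le> norm (B * cmod (fourier_transform \<phi> t))"
      using B B0 by (auto simp: norm_mult abs_mult intro!: mult_right_mono)
    show "(\<lambda>t. H t * fourier_transform \<phi> t) \<in> borel_measurable lborel"
      using schwartz_measurable[OF that] by measurable
  qed
  have ft_add: "fourier_transform (\<lambda>y. \<phi> y + \<psi> y) = (\<lambda>t. fourier_transform \<phi> t + fourier_transform \<psi> t)"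
    if "schwartz \<phi>" "schwartz \<psi>" for \<phi> \<psi>
    using that by (auto simp: fourier_transform_add schwartz_integrable)
  have ft_diff: "fourier_transform (\<lambda>y. \<phi> y - \<psi> y) = (\<lambda>t. fourier_transform \<phi> t - fourier_transform \<psi> t)"
    if "schwartz \<phi>" "schwartz \<psi>" for \<phi> \<psi>
    using that by (auto simp: fourier_transform_diff schwartz_integrable)
  have "?T (\<lambda>y. \<phi> y + \<psi> y) = ?T \<phi> + ?T \<psi>" if "schwartz \<phi>" "schwartz \<psi>" for \<phi> \<psi>
  proof -
    have "?T (\<lambda>y. \<phi> y + \<psi> y) = (\<integral>t. H t * (fourier_transform \<phi> t + fourier_transform \<psi> t) \<partial>lborel)"
      using schwartz_measurable[OF that(1)] schwartz_measurable[OF that(2)]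
      by (simp add: distribution_fourier_def ft_add[OF that] distribution_of_fun_lborel)
    then show ?thesis
      using int[OF that(1)] int[OF that(2)] by (simp add: T that distrib_left)
  qed
  moreover have "?T (\<lambda>y. c * \<phi> y) = c * ?T \<phi>" if "schwartz \<phi>" for \<phi> c
    by (simp add: distribution_fourier_def distribution_of_fun_def fourier_transform_cmult
        mult.left_commute)
  moreover have "\<exists>\<delta>>0. \<exists>m. \<forall>\<psi>. schwartz \<psi> \<longrightarrow>
      (\<forall>j\<le>m. \<forall>k\<le>m. schwartz_seminorm j k (\<lambda>y. \<psi> y - \<phi> y) < \<delta>) \<longrightarrow> cmod (?T \<psi> - ?T \<phi>) < \<epsilon>"
    if \<phi>: "schwartz \<phi>" and "\<epsilon> > 0" for \<phi> \<epsilon>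
  proof (intro exI conjI allI impI)
    \<comment> \<open>Only seminorms of orders 0 and 2 occur, so the witness \<open>m\<close> is 2.
      Four of them below \<open>\<delta>\<close> bound the L1 norm by
      \<open>4 * pi^2 * \<delta>\<close>. Using \<open>B + 1\<close> in place of \<open>B\<close>
      keeps the denominator positive and the final inequality strict.\<close>
    define \<delta> where "\<delta> = \<epsilon> / (4 * (B + 1) * pi\<^sup>2)"
    show "\<delta> > 0" using B0 \<open>\<epsilon> > 0\<close> by (simp add: \<delta>_def)
    fix \<psi>
    assume \<psi>: "schwartz \<psi>"
      and *: "\<forall>j\<le>2. \<forall>k\<le>2. schwartz_seminorm j k (\<lambda>y. \<psi> y - \<phi> y) < \<delta>"
    have d: "schwartz (\<lambda>y. \<psi> y - \<phi> y)" by (rule schwartz_diff[OF \<psi> \<phi>])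
    have "(\<integral>t. cmod (fourier_transform (\<lambda>y. \<psi> y - \<phi> y) t) \<partial>lborel) \<le> pi\<^sup>2 *
       (schwartz_seminorm 0 0 (\<lambda>y. \<psi> y - \<phi> y) + schwartz_seminorm 2 0 (\<lambda>y. \<psi> y - \<phi> y)
        + schwartz_seminorm 0 2 (\<lambda>y. \<psi> y - \<phi> y) + schwartz_seminorm 2 2 (\<lambda>y. \<psi> y - \<phi> y))"
      by (rule integral_norm_fourier_transform_le[OF d])
    also have "\<dots> < pi\<^sup>2 * (4 * \<delta>)"
    proof (rule mult_strict_left_mono)
      show "schwartz_seminorm 0 0 (\<lambda>y. \<psi> y - \<phi> y) + schwartz_seminorm 2 0 (\<lambda>y. \<psi> y - \<phi> y)
        + schwartz_seminorm 0 2 (\<lambda>y. \<psi> y - \<phi> y) + schwartz_seminorm 2 2 (\<lambda>y. \<psi> y - \<phi> y) < 4 * \<delta>"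
        using *[rule_format, of 0 0] *[rule_format, of 2 0] *[rule_format, of 0 2]
          *[rule_format, of 2 2] by simp
    qed simp
    finally have I: "(\<integral>t. cmod (fourier_transform (\<lambda>y. \<psi> y - \<phi> y) t) \<partial>lborel) < pi\<^sup>2 * (4 * \<delta>)" .
    have "?T \<psi> - ?T \<phi> = (\<integral>t. H t * fourier_transform (\<lambda>y. \<psi> y - \<phi> y) t \<partial>lborel)"
      using int[OF \<phi>] int[OF \<psi>] by (simp add: T \<phi> \<psi> ft_diff right_diff_distrib)
    then have "cmod (?T \<psi> - ?T \<phi>) \<le> B * (\<integral>t. cmod (fourier_transform (\<lambda>y. \<psi> y - \<phi> y) t) \<partial>lborel)"
      using cmod_integral_bounded_mult_le[OF integrable_fourier_transform_schwartz[OF d] B] by simp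
    also have "\<dots> \<le> B * (pi\<^sup>2 * (4 * \<delta>))"
      using I B0 by (intro mult_left_mono) auto
    also have "\<dots> < (B + 1) * (pi\<^sup>2 * (4 * \<delta>))"
      using \<open>\<delta> > 0\<close> by (intro mult_strict_right_mono) auto
    also have "\<dots> = \<delta> * (4 * (B + 1) * pi\<^sup>2)" by (simp only: mult_ac)
    also have "\<dots> = \<epsilon>" using B0 by (simp add: \<delta>_def)
    finally show "cmod (?T \<psi> - ?T \<phi>) < \<epsilon>" .
  qed
  ultimately show ?thesis unfolding tempered_distribution_def by blast
qed

section \<open>Gaussian test functions\<close>

text \<open>The inequality \<open>(1 + s / n) ^ n \<le> exp s\<close> at \<open>s = y^2 / 2\<close>
  gives \<open>y^(2n) \<le> (2n)^n * exp (y^2 / 2)\<close>, while the power of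
  \<open>\<bar>y\<bar>\<close> is at most \<open>1 + y^(2n)\<close>.\<close>

lemma power_mult_exp_minus_square_le:
  fixes y :: real
  shows "\<bar>y\<bar> ^ n * exp (- (y\<^sup>2 / 2)) \<le> 1 + (2 * real n) ^ n"
proof (cases "n = 0")
  case False
  have 1: "exp (- (y\<^sup>2 / 2)) \<le> 1" by simp
  have "\<bar>y\<bar> ^ n \<le> 1 + (y\<^sup>2) ^ n"
  proof (cases "\<bar>y\<bar> \<le> 1")
    case True
    then have "\<bar>y\<bar> ^ n \<le> 1" by (simp add: power_le_one)
    then show ?thesis by (smt (verit) zero_le_power zero_le_power2)
  next
    case False
    then have "\<bar>y\<bar> \<le> y\<^sup>2"
      by (metis abs_ge_zero linorder_not_le mult_left_mono mult.right_neutral power2_abs power2_eq_square less_imp_le)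
    then have "\<bar>y\<bar> ^ n \<le> (y\<^sup>2) ^ n" by (simp add: power_mono)
    then show ?thesis by simp
  qed
  moreover have "(y\<^sup>2) ^ n \<le> (2 * real n) ^ n * exp (y\<^sup>2 / 2)"
  proof -
    have "(y\<^sup>2 / 2 / real n) ^ n \<le> (1 + y\<^sup>2 / 2 / real n) ^ n"
      by (intro power_mono) auto
    also have "\<dots> \<le> exp (y\<^sup>2 / 2)"
      using False by (intro exp_ge_one_plus_x_over_n_power_n) (auto intro: order_trans[of _ 0])
    finally have "(2 * real n) ^ n * (y\<^sup>2 / 2 / real n) ^ n \<le> (2 * real n) ^ n * exp (y\<^sup>2 / 2)"
      by (intro mult_left_mono) auto
    moreover have "2 * real n * (y\<^sup>2 / 2 / real n) = y\<^sup>2" using False by simp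
    ultimately show ?thesis by (simp only: power_mult_distrib[symmetric])
  qed
  ultimately have "\<bar>y\<bar> ^ n \<le> 1 + (2 * real n) ^ n * exp (y\<^sup>2 / 2)" by linarith
  then have "\<bar>y\<bar> ^ n * exp (- (y\<^sup>2 / 2)) \<le> (1 + (2 * real n) ^ n * exp (y\<^sup>2 / 2)) * exp (- (y\<^sup>2 / 2))"
    by (intro mult_right_mono) auto
  moreover have "exp (y\<^sup>2 / 2) * exp (- (y\<^sup>2 / 2)) = 1" by (simp flip: exp_add)
  ultimately show ?thesis using 1 by (simp only: distrib_right mult.assoc)
qed (auto intro: order_trans[of _ 1])

text \<open>For imaginary \<open>c\<close> the linear term of the exponent only contributes a phase,
  so the modulus of the exponential is the plain Gaussian and each monomial can be bounded
  separately.\<close>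

lemma bounded_poly_times_gaussian:
  assumes "Re c = 0"
  shows "bounded (range (\<lambda>y. poly p (complex_of_real y) * exp (c * of_real y - (of_real y)\<^sup>2 / 2)))"
proof (rule boundedI, clarify)
  fix y :: real
  have *: "cmod (exp (c * of_real y - (of_real y)\<^sup>2 / 2)) = exp (- (y\<^sup>2 / 2))"
    using assms by (simp flip: of_real_power)
  have "cmod (poly p (of_real y)) \<le> (\<Sum>i\<le>degree p. cmod (coeff p i) * \<bar>y\<bar> ^ i)"
    unfolding poly_altdef by (rule sum_norm_le) (simp add: norm_mult norm_power)
  then have "cmod (poly p (of_real y)) * exp (- (y\<^sup>2 / 2))
      \<le> (\<Sum>i\<le>degree p. cmod (coeff p i) * \<bar>y\<bar> ^ i) * exp (- (y\<^sup>2 / 2))"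
    by (rule mult_right_mono) simp
  also have "\<dots> = (\<Sum>i\<le>degree p. cmod (coeff p i) * (\<bar>y\<bar> ^ i * exp (- (y\<^sup>2 / 2))))"
    by (simp add: sum_distrib_right mult.assoc)
  also have "\<dots> \<le> (\<Sum>i\<le>degree p. cmod (coeff p i) * (1 + (2 * real i) ^ i))"
    by (intro sum_mono mult_left_mono power_mult_exp_minus_square_le) auto
  finally show "cmod (poly p (of_real y) * exp (c * of_real y - (of_real y)\<^sup>2 / 2))
      \<le> (\<Sum>i\<le>degree p. cmod (coeff p i) * (1 + (2 * real i) ^ i))"
    by (simp only: norm_mult *)
qed

lemma has_vector_derivative_poly_times_gaussian:
  "((\<lambda>y. poly p (complex_of_real y) * exp (c * of_real y - (of_real y)\<^sup>2 / 2)) has_vector_derivative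
    poly (pderiv p + p * [:c, -1:]) (of_real y) * exp (c * of_real y - (of_real y)\<^sup>2 / 2)) (at y)"
  by (rule has_vector_derivative_real_field)
     (auto intro!: derivative_eq_intros poly_DERIV simp: algebra_simps)

text \<open>Polynomial multiples of the Gaussian are closed under differentiation, so every
  derivative is one of them. A power of \<open>y\<close> is absorbed into the polynomial as a
  monomial factor.\<close>

lemma schwartz_gaussian:
  assumes "Re c = 0"
  shows "schwartz (\<lambda>y. exp (c * complex_of_real y - (of_real y)\<^sup>2 / 2))"
proof -
  let ?g = "\<lambda>y. exp (c * complex_of_real y - (of_real y)\<^sup>2 / 2)"
  have D: "\<exists>p. iterated_deriv k ?g = (\<lambda>y. poly p (of_real y) * ?g y)" for k
  proof (induction k)
    case 0
    show ?case by (rule exI[of _ 1]) simp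
  next
    case (Suc k)
    then obtain p where "iterated_deriv k ?g = (\<lambda>y. poly p (of_real y) * ?g y)" by blast
    then show ?case
      by (auto simp: iterated_deriv_Suc intro!: exI[of _ "pderiv p + p * [:c, -1:]"]
          vector_derivative_at has_vector_derivative_poly_times_gaussian simp del: poly_add)
  qed
  show ?thesis
    unfolding schwartz_def
  proof (intro conjI allI)
    fix k y
    obtain p where p: "iterated_deriv k ?g = (\<lambda>y. poly p (of_real y) * ?g y)" using D by blast
    show "iterated_deriv k ?g differentiable at y"
      unfolding p by (rule differentiableI_vector[OF has_vector_derivative_poly_times_gaussian])
  next
    fix j k
    obtain p where p: "iterated_deriv k ?g = (\<lambda>y. poly p (of_real y) * ?g y)" using D by blast
    show "bounded (range (\<lambda>y. complex_of_real (y ^ j) * iterated_deriv k ?g y))"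
      using bounded_poly_times_gaussian[OF assms, of "monom 1 j * p"]
      by (simp add: p poly_monom mult.assoc)
  qed
qed

text \<open>This is the characteristic function of the standard normal distribution at
  \<open>u - t\<close>. The factor \<open>sqrt (2 * pi)\<close> undoes the normalization of the
  density, and the modulation by \<open>u\<close> translates the transform.\<close>

lemma fourier_transform_gaussian:
  "fourier_transform (\<lambda>y. exp (\<i> * of_real u * of_real y - (of_real y)\<^sup>2 / 2)) t
    = of_real (sqrt (2 * pi) * exp (- (t - u)\<^sup>2 / 2))"
proof -
  let ?g = "\<lambda>y. exp (\<i> * complex_of_real u * of_real y - (of_real y)\<^sup>2 / 2)"
  have [measurable]: "?g \<in> borel_measurable borel"
    by (rule schwartz_measurable[OF schwartz_gaussian]) simp
  have "(\<integral>y. std_normal_density y *\<^sub>R iexp ((u - t) * y) \<partial>lborel) = char std_normal_distribution (u - t)"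
    unfolding char_def by (subst integral_density) auto
  also have "\<dots> = of_real (exp (- (t - u)\<^sup>2 / 2))"
    by (simp add: char_std_normal_distribution power2_commute)
  finally have "of_real (sqrt (2 * pi)) * (\<integral>y. std_normal_density y *\<^sub>R iexp ((u - t) * y) \<partial>lborel)
      = complex_of_real (sqrt (2 * pi) * exp (- (t - u)\<^sup>2 / 2))"
    by simp
  moreover have "of_real (sqrt (2 * pi)) * (std_normal_density y *\<^sub>R iexp ((u - t) * y))
      = ?g y * exp (- (\<i> * complex_of_real (t * y)))" for y
  proof -
    have "of_real (sqrt (2 * pi)) * (std_normal_density y *\<^sub>R iexp ((u - t) * y))
        = complex_of_real (exp (- y\<^sup>2 / 2)) * iexp ((u - t) * y)"
      by (simp add: std_normal_density_def scaleR_conv_of_real del: real_sqrt_mult)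
    also have "\<dots> = ?g y * exp (- (\<i> * complex_of_real (t * y)))"
      by (simp add: exp_of_real[symmetric] algebra_simps flip: exp_add)
    finally show ?thesis .
  qed
  ultimately show ?thesis
    by (simp add: fourier_transform_lborel flip: integral_mult_right_zero)
qed

section \<open>Dirichlet series as Laplace transforms\<close>

text \<open>The antiderivative \<open>- exp (- z * t) / z\<close> vanishes at infinity because
  \<open>Re z > 0\<close>. With \<open>b = ln n\<close> the value is \<open>n^(-z) / z\<close>, the
  contribution of one term of the Dirichlet series to the quotient.\<close>

lemma
  assumes "0 < Re z" "0 \<le> b"
  shows integrable_exp_Ioi: "integrable lborel (\<lambda>t. indicator {b<..} t *\<^sub>R exp (- (z * complex_of_real t)))"
    and integral_exp_Ioi: "(\<integral>t. indicator {b<..} t *\<^sub>R exp (- (z * complex_of_real t)) \<partial>lborel)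
      = exp (- (z * of_real b)) / z"
proof -
  have "set_integrable lborel {b<..} (\<lambda>t. exp (- (t * Re z)))"
    by (rule set_integrable_subset[OF integrable_I0i_exp_mscale[OF assms(1)]]) (use assms in auto)
  then have "integrable lborel (\<lambda>t. indicator {b<..} t *\<^sub>R exp (- (t * Re z)))"
    by (simp add: set_integrable_def)
  then show int: "integrable lborel (\<lambda>t. indicator {b<..} t *\<^sub>R exp (- (z * complex_of_real t)))"
    by (rule Bochner_Integration.integrable_bound) (auto simp: indicator_def mult.commute)
  have z: "z \<noteq> 0" using assms by auto
  let ?F = "\<lambda>t. - exp (- z * complex_of_real t) / z"
  have "(LBINT t=ereal b..\<infinity>. exp (- z * complex_of_real t)) = 0 - ?F b"
  proof (rule interval_integral_FTC_integrable)
    show "(?F has_vector_derivative exp (- z * complex_of_real t)) (at t)" for t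
      using has_vector_derivative_mult_right[OF has_vector_derivative_exp_of_real[of "- z" t UNIV], of "- inverse z"] z
      by (simp add: field_simps)
    show "set_integrable lborel (einterval (ereal b) \<infinity>) (\<lambda>t. exp (- z * complex_of_real t))"
      using int by (simp add: set_integrable_def)
    have "(?F \<longlongrightarrow> 0) at_top"
    proof (rule tendsto_norm_zero_cancel)
      have "((\<lambda>t. exp (- (r * t))) \<longlongrightarrow> 0) at_top" if "r > 0" for r :: real
        using that by real_asymp
      from tendsto_divide_zero[OF this[OF assms(1)], of "cmod z"] show "((\<lambda>t. cmod (?F t)) \<longlongrightarrow> 0) at_top"
        by (simp add: norm_divide)
    qed
    then show "((?F \<circ> real_of_ereal) \<longlongrightarrow> 0) (at_left \<infinity>)"
      by (simp add: ereal_tendsto_simps)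
    have "isCont ?F b" using z by (intro continuous_intros) auto
    then show "((?F \<circ> real_of_ereal) \<longlongrightarrow> ?F b) (at_right (ereal b))"
      by (simp add: ereal_tendsto_simps isCont_def tendsto_within_subset[where S=UNIV])
  qed (auto intro!: continuous_intros)
  then show "(\<integral>t. indicator {b<..} t *\<^sub>R exp (- (z * complex_of_real t)) \<partial>lborel)
      = exp (- (z * of_real b)) / z"
    by (simp add: interval_lebesgue_integral_def set_lebesgue_integral_def)
qed

text \<open>The strict inequality lets each coefficient enter through the indicator of an open
  half-line \<open>{ln n<..}\<close>. It also makes the function vanish at \<open>t = 0\<close>,
  even though \<open>ln 1 = 0\<close>.\<close>

definition summatory :: "(nat \<Rightarrow> real) \<Rightarrow> real \<Rightarrow> real" where
  "summatory a t = (\<Sum>n | 1 \<le> n \<and> ln (real n) < t. a n)"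

lemma finite_ln_less: "finite {n. 1 \<le> n \<and> ln (real n) < t}"
proof (rule finite_subset)
  show "{n. 1 \<le> n \<and> ln (real n) < t} \<subseteq> {..nat \<lceil>exp t\<rceil>}"
  proof clarify
    fix n :: nat
    assume "1 \<le> n" "ln (real n) < t"
    then have "real n < exp t" by (metis ln_ge_iff not_le of_nat_0_less_iff zero_less_one order_less_le_trans)
    then show "n \<le> nat \<lceil>exp t\<rceil>" by linarith
  qed
qed simp

text \<open>At a fixed \<open>t\<close> only finitely many terms are nonzero. Written as a series,
  the function can be integrated term by term; the shift to \<open>Suc n\<close> matches the
  indexing of the Dirichlet series.\<close>

lemma sums_summatory:
  "(\<lambda>n. indicator {ln (real (Suc n))<..} t * a (Suc n)) sums summatory a t"
proof -
  have eq: "{n. 1 \<le> n \<and> ln (real n) < t} = Suc ` {n. ln (real (Suc n)) < t}"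
    by (auto simp: image_iff) (metis Suc_pred' of_nat_Suc less_eq_Suc_le)
  have "finite {n. ln (real (Suc n)) < t}"
    using finite_ln_less[of t] unfolding eq by (rule finite_imageD) simp
  then have "(\<lambda>n. indicator {ln (real (Suc n))<..} t * a (Suc n)) sums
      (\<Sum>n | ln (real (Suc n)) < t. indicator {ln (real (Suc n))<..} t * a (Suc n))"
    by (rule sums_finite) auto
  also have "(\<Sum>n | ln (real (Suc n)) < t. indicator {ln (real (Suc n))<..} t * a (Suc n)) = summatory a t"
    unfolding summatory_def eq by (subst sum.reindex) auto
  finally show ?thesis .
qed

lemma summatory_nonneg: "(\<And>n. n \<ge> 1 \<Longrightarrow> a n \<ge> 0) \<Longrightarrow> summatory a t \<ge> 0"
  unfolding summatory_def by (rule sum_nonneg) auto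

lemma sum_le_summatory:
  assumes "\<And>n. n \<ge> 1 \<Longrightarrow> a n \<ge> 0" "ln (real N) < t"
  shows "(\<Sum>n = 1..N. a n) \<le> summatory a t"
  unfolding summatory_def
proof (rule sum_mono2[OF finite_ln_less])
  show "{1..N} \<subseteq> {n. 1 \<le> n \<and> ln (real n) < t}"
    using assms(2) by (auto intro: order.strict_trans1[rotated])
qed (use assms in auto)

lemma summatory_le_sum:
  assumes "\<And>n. n \<ge> 1 \<Longrightarrow> a n \<ge> 0"
  shows "summatory a t \<le> (\<Sum>n = 1..nat \<lfloor>exp t\<rfloor>. a n)"
  unfolding summatory_def
proof (rule sum_mono2)
  show "{n. 1 \<le> n \<and> ln (real n) < t} \<subseteq> {1..nat \<lfloor>exp t\<rfloor>}"
  proof clarify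
    fix n :: nat
    assume "1 \<le> n" "ln (real n) < t"
    then have "real n < exp t" by (metis ln_ge_iff not_le of_nat_0_less_iff zero_less_one order_less_le_trans)
    then show "n \<in> {1..nat \<lfloor>exp t\<rfloor>}" using \<open>1 \<le> n\<close> by (simp add: le_nat_floor)
  qed
qed (use assms in auto)

lemma exp_minus_mult_ln:
  assumes "n > 0"
  shows "exp (- (z * complex_of_real (ln (real n)))) = 1 / of_nat n powr z"
  using assms by (simp add: powr_def exp_minus divide_inverse Ln_of_nat)

text \<open>The Laplace transform of the summatory function is integrated term by term. Absolute
  convergence at \<open>Re z\<close> makes the L1 norms of the terms summable, which justifies
  exchanging sum and integral.\<close>

lemma
  assumes z: "Re z > 0"
    and abs: "summable (\<lambda>n. \<bar>a (Suc n)\<bar> / real (Suc n) powr Re z)"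
    and F: "(\<lambda>n. complex_of_real (a (Suc n)) / of_nat (Suc n) powr z) sums F"
  shows integrable_summatory_exp:
      "integrable lborel (\<lambda>t. of_real (summatory a t) * exp (- (z * complex_of_real t)))"
    and integral_summatory_exp:
      "(\<integral>t. of_real (summatory a t) * exp (- (z * complex_of_real t)) \<partial>lborel) = F / z"
proof -
  define G where "G n t = of_real (a (Suc n)) *
      (indicator {ln (real (Suc n))<..} t *\<^sub>R exp (- (z * complex_of_real t)))" for n t
  have b: "0 \<le> ln (real (Suc n))" for n by simp
  have int: "integrable lborel (G n)" for n
    unfolding G_def by (intro integrable_mult_right integrable_exp_Ioi[OF z b])
  have "integral\<^sup>L lborel (G n) = of_real (a (Suc n)) / of_nat (Suc n) powr z / z" for n
    unfolding G_def integral_mult_right_zero integral_exp_Ioi[OF z b] exp_minus_mult_ln[OF zero_less_Suc]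
    by simp
  then have Fz: "(\<lambda>n. integral\<^sup>L lborel (G n)) sums (F / z)"
    using sums_divide[OF F, of z] by simp
  have sumG: "(\<lambda>n. G n t) sums (of_real (summatory a t) * exp (- (z * complex_of_real t)))" for t
  proof -
    have "(\<lambda>n. of_real (indicator {ln (real (Suc n))<..} t * a (Suc n)) * exp (- (z * complex_of_real t))) sums
        (of_real (summatory a t) * exp (- (z * complex_of_real t)))"
      by (intro sums_mult2 sums_of_real sums_summatory)
    then show ?thesis
      by (simp add: G_def scaleR_conv_of_real mult_ac)
  qed
  have normG: "norm (G n t) = \<bar>a (Suc n)\<bar> * (indicator {ln (real (Suc n))<..} t * exp (- (Re z * t)))" for n t
    by (simp add: G_def norm_mult)
  have s1: "AE t in lborel. summable (\<lambda>n. norm (G n t))"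
  proof (rule AE_I2)
    fix t
    have "(\<lambda>n. indicator {ln (real (Suc n))<..} t * \<bar>a (Suc n)\<bar> * exp (- (Re z * t))) sums
        (summatory (\<lambda>n. \<bar>a n\<bar>) t * exp (- (Re z * t)))"
      by (intro sums_mult2 sums_summatory)
    then show "summable (\<lambda>n. norm (G n t))"
      unfolding normG by (simp add: sums_iff mult_ac)
  qed
  have "(\<integral>t. norm (G n t) \<partial>lborel) = \<bar>a (Suc n)\<bar> / real (Suc n) powr Re z / Re z" for n
  proof -
    \<comment> \<open>The norm of a term is the same exponential with \<open>z\<close> replaced by
      \<open>Re z\<close>, so its integral is the complex formula at a real point.\<close>
    have "complex_of_real (\<integral>t. indicator {ln (real (Suc n))<..} t * exp (- (Re z * t)) \<partial>lborel)
        = (\<integral>t. indicator {ln (real (Suc n))<..} t *\<^sub>R exp (- (of_real (Re z) * complex_of_real t)) \<partial>lborel)"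
      by (simp add: scaleR_conv_of_real exp_of_real[symmetric] del: integral_complex_of_real
          flip: integral_complex_of_real)
    also have "\<dots> = exp (- (of_real (Re z) * of_real (ln (real (Suc n))))) / of_real (Re z)"
      using integral_exp_Ioi[of "of_real (Re z)", OF _ b] z by simp
    also have "\<dots> = of_real (exp (- (Re z * ln (real (Suc n)))) / Re z)"
      by (simp add: exp_of_real[symmetric])
    finally have "(\<integral>t. indicator {ln (real (Suc n))<..} t * exp (- (Re z * t)) \<partial>lborel)
        = exp (- (Re z * ln (real (Suc n)))) / Re z"
      by (simp only: of_real_eq_iff)
    then show ?thesis
      by (simp add: normG powr_def exp_minus divide_inverse)
  qed
  then have s2: "summable (\<lambda>n. \<integral>t. norm (G n t) \<partial>lborel)"
    using summable_divide[OF abs, of "Re z"] by simp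
  have "(\<Sum>n. G n t) = of_real (summatory a t) * exp (- (z * complex_of_real t))" for t
    using sumG[of t] by (simp add: sums_iff)
  then show "integrable lborel (\<lambda>t. of_real (summatory a t) * exp (- (z * complex_of_real t)))"
    and "(\<integral>t. of_real (summatory a t) * exp (- (z * complex_of_real t)) \<partial>lborel) = F / z"
    using integrable_suminf[OF int s1 s2] sums_integral[OF int s1 s2] Fz by (simp_all add: sums_unique2)
qed

section \<open>The boundedness criterion\<close>

theorem theorem1p3:
  fixes a :: "nat \<Rightarrow> real" and f q :: "complex \<Rightarrow> complex" and s :: "nat \<Rightarrow> real"
  assumes a_nonneg: "\<And>n. n \<ge> 1 \<Longrightarrow> a n \<ge> 0"
    and f: "\<And>z. Re z > 1 \<Longrightarrow>
      (\<lambda>n. complex_of_real (a (Suc n)) / of_nat (Suc n) powr z) sums f z"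
    and s: "\<And>N. N \<ge> 1 \<Longrightarrow> s N = (\<Sum>n = 1..N. a n)"
    and q: "\<And>z. Re z > 1 \<Longrightarrow> q z = f z / z"
  shows "bounded ((\<lambda>N. s N / real N) ` {1..}) \<longleftrightarrow>
    (\<exists>T. pseudomeasure T \<and>
       tempered_tendsto (\<lambda>x. distribution_of_fun (\<lambda>y. q (Complex x y))) T (at_right 1))"
proof -

  \<comment> \<open>The quotient as a Fourier transform\<close>
  define G where "G x t = complex_of_real (summatory a t * exp (- (x * t)))" for x t :: real
  \<comment> \<open>Nonnegative coefficients make convergence at the real point \<open>x\<close>
    absolute; this covers the whole line \<open>Re z = x\<close>.\<close>
  have abs: "summable (\<lambda>n. \<bar>a (Suc n)\<bar> / real (Suc n) powr x)" if "x > 1" for x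
  proof -
    have "complex_of_real (a (Suc n)) / of_nat (Suc n) powr of_real x
        = of_real (\<bar>a (Suc n)\<bar> / real (Suc n) powr x)" for n
      using a_nonneg[of "Suc n"] powr_of_real[of "real (Suc n)" x] by simp
    then have "summable (\<lambda>n. complex_of_real (\<bar>a (Suc n)\<bar> / real (Suc n) powr x))"
      using f[of "of_real x"] that by (simp add: sums_iff del: of_nat_Suc)
    then show ?thesis by (simp only: summable_of_real_iff)
  qed
  have G_split: "G x t * exp (- (\<i> * complex_of_real (y * t)))
      = of_real (summatory a t) * exp (- (Complex x y * complex_of_real t))" for x y t
    by (simp add: G_def Complex_eq exp_of_real[symmetric] algebra_simps flip: exp_add)
  have G_int: "integrable lborel (G x)" if "x > 1" for x
  proof -
    have "G x = (\<lambda>t. of_real (summatory a t) * exp (- (Complex x 0 * complex_of_real t)))"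
      using G_split[of x _ 0] by (intro ext) simp
    then show ?thesis
      using integrable_summatory_exp[of "Complex x 0" a, OF _ _ f] abs[OF that] that by simp
  qed
  have q_eq: "q (Complex x y) = fourier_transform (G x) y" if "x > 1" for x y
  proof -
    have "fourier_transform (G x) y = f (Complex x y) / Complex x y"
      using integral_summatory_exp[of "Complex x y" a, OF _ _ f] abs[OF that] that
        borel_measurable_integrable[OF G_int[OF that]]
      by (simp add: fourier_transform_lborel G_split del: of_real_mult)
    then show ?thesis using q that by simp
  qed
  have qT: "distribution_of_fun (\<lambda>y. q (Complex x y)) \<phi> = (\<integral>t. G x t * fourier_transform \<phi> t \<partial>lborel)"
    if "x > 1" "schwartz \<phi>" for x \<phi>
    using distribution_of_fourier_transform[OF G_int[OF that(1)] that(2)] that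
    by (simp add: q_eq)
  have G_norm: "cmod (G x t) = summatory a t * exp (- (x * t))" for x t
    using summatory_nonneg[of a t] a_nonneg by (simp add: G_def abs_mult norm_mult)
  show ?thesis
  proof

    \<comment> \<open>From bounded averages to a pseudomeasure limit\<close>
    assume "bounded ((\<lambda>N. s N / real N) ` {1..})"
    then obtain B where B: "\<And>N. N \<ge> 1 \<Longrightarrow> \<bar>s N / real N\<bar> \<le> B"
      unfolding bounded_iff by auto
    have B0: "B \<ge> 0" using B[of 1] by linarith
    have sb: "summatory a t \<le> B * exp t" if "t \<ge> 0" for t
    proof -
      define N where "N = nat \<lfloor>exp t\<rfloor>"
      have "exp t \<ge> 1" using that by simp
      then have N: "N \<ge> 1" "real N \<le> exp t" unfolding N_def by linarith+
      have "summatory a t \<le> s N"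
        using summatory_le_sum[of a t] a_nonneg N s by (simp add: N_def)
      also have "\<dots> \<le> B * real N"
        using B[OF N(1)] N(1) by (simp add: divide_le_eq abs_le_iff)
      also have "\<dots> \<le> B * exp t" using N B0 by (intro mult_left_mono) auto
      finally show ?thesis .
    qed
    have sneg: "summatory a t = 0" if "t \<le> 0" for t
      using that unfolding summatory_def by (intro sum.neutral) (smt (verit) ln_ge_zero mem_Collect_eq of_nat_1 of_nat_le_iff)
    \<comment> \<open>The bound is uniform in \<open>x \<ge> 1\<close>. At \<open>x = 1\<close> it
      makes \<open>G 1\<close> an admissible bounded function, and for \<open>x > 1\<close> it
      supplies the dominating function.\<close>
    have Gb: "cmod (G x t) \<le> B" if "x \<ge> 1" for x t
    proof (cases "t \<ge> 0")
      case True
      have "cmod (G x t) \<le> B * exp t * exp (- (x * t))"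
        unfolding G_norm using sb[OF True] by (intro mult_right_mono) auto
      also have "\<dots> = B * exp ((1 - x) * t)" by (simp add: algebra_simps flip: exp_add)
      also have "\<dots> \<le> B * 1"
        using B0 that True by (intro mult_left_mono) (auto simp: mult_nonpos_nonneg)
      finally show ?thesis by simp
    qed (use B0 sneg[of t] G_norm in simp)
    have G_meas [measurable]: "G x \<in> borel_measurable borel" for x
    proof -
      \<comment> \<open>Integrability yields measurability only for \<open>x > 1\<close>.
        Multiplying \<open>G 2\<close> by a continuous factor reaches every \<open>x\<close>,
        including the limit case 1.\<close>
      have "(\<lambda>t. G 2 t * of_real (exp ((2 - x) * t))) \<in> borel_measurable borel"
        using borel_measurable_integrable[OF G_int[of 2]] by simp
      also have "(\<lambda>t. G 2 t * of_real (exp ((2 - x) * t))) = G x"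
        by (rule ext) (simp add: G_def algebra_simps flip: of_real_mult exp_add)
      finally show ?thesis .
    qed
    let ?T = "distribution_fourier (distribution_of_fun (G 1))"
    have "pseudomeasure ?T"
      unfolding pseudomeasure_def
    proof (intro conjI exI[of _ "G 1"] allI impI refl)
      show "tempered_distribution ?T"
        by (rule tempered_distribution_fourier_bounded[OF G_meas Gb]) simp
      show "G 1 \<in> borel_measurable lebesgue"
        by (intro measurable_completion) simp
      show "bounded (range (G 1))"
        using Gb[of 1] by (auto simp: bounded_iff)
    qed
    moreover have "tempered_tendsto (\<lambda>x. distribution_of_fun (\<lambda>y. q (Complex x y))) ?T (at_right 1)"
      \<comment> \<open>Passing to sequences makes the dominated convergence theorem
        applicable.\<close>
      unfolding tempered_tendsto_def tendsto_at_iff_sequentially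
    proof (intro allI impI)
      fix \<phi> and X :: "nat \<Rightarrow> real"
      assume \<phi>: "schwartz \<phi>" and "\<forall>i. X i \<in> {1<..} - {1}" and X: "X \<longlonglongrightarrow> 1"
      then have X1: "X i > 1" for i by simp
      have [measurable]: "fourier_transform \<phi> \<in> borel_measurable borel"
        using schwartz_measurable[OF \<phi>] by simp
      have "(\<lambda>i. \<integral>t. G (X i) t * fourier_transform \<phi> t \<partial>lborel)
          \<longlonglongrightarrow> (\<integral>t. G 1 t * fourier_transform \<phi> t \<partial>lborel)"
      proof (rule integral_dominated_convergence)
        show "integrable lborel (\<lambda>t. B * cmod (fourier_transform \<phi> t))"
          using integrable_fourier_transform_schwartz[OF \<phi>] by simp
        show "AE t in lborel. (\<lambda>i. G (X i) t * fourier_transform \<phi> t) \<longlonglongrightarrow> G 1 t * fourier_transform \<phi> t"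
          unfolding G_def by (intro AE_I2 tendsto_intros X)
        show "AE t in lborel. cmod (G (X i) t * fourier_transform \<phi> t) \<le> B * cmod (fourier_transform \<phi> t)" for i
          using Gb[OF less_imp_le[OF X1]] by (auto simp: norm_mult intro!: mult_right_mono)
      qed measurable
      then show "((\<lambda>x. distribution_of_fun (\<lambda>y. q (Complex x y)) \<phi>) \<circ> X) \<longlonglongrightarrow> ?T \<phi>"
        using qT[OF X1 \<phi>] by (simp add: o_def distribution_fourier_def distribution_of_fun_lborel)
    qed
    ultimately show "\<exists>T. pseudomeasure T \<and>
       tempered_tendsto (\<lambda>x. distribution_of_fun (\<lambda>y. q (Complex x y))) T (at_right 1)" by blast
  next

    \<comment> \<open>From a pseudomeasure limit to bounded averages\<close>
    assume "\<exists>T. pseudomeasure T \<and>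
       tempered_tendsto (\<lambda>x. distribution_of_fun (\<lambda>y. q (Complex x y))) T (at_right 1)"
    then obtain T H where H: "bounded (range H)"
      and TH: "\<And>\<phi>. schwartz \<phi> \<Longrightarrow> T \<phi> = distribution_fourier (distribution_of_fun H) \<phi>"
      and lim: "\<And>\<phi>. schwartz \<phi> \<Longrightarrow>
        ((\<lambda>x. distribution_of_fun (\<lambda>y. q (Complex x y)) \<phi>) \<longlongrightarrow> T \<phi>) (at_right 1)"
      unfolding pseudomeasure_def tempered_tendsto_def by blast
    obtain B where B: "\<And>t. cmod (H t) \<le> B"
      using H by (auto simp: bounded_iff)
    define k where "k t = sqrt (2 * pi) * exp (- t\<^sup>2 / 2)" for t :: real
    have k_eq: "k t = 2 * pi * std_normal_density t" for t
      by (simp add: k_def std_normal_density_def real_sqrt_mult field_simps)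
    have k_int: "integrable lborel k"
      unfolding k_eq[abs_def] by (simp add: integrable_normal_density)
    define K where "K = (\<integral>t. k t \<partial>lborel)"
    \<comment> \<open>The value \<open>k 1\<close>, the minimum of the Gaussian on
      \<open>[0, 1]\<close>.\<close>
    define m where "m = sqrt (2 * pi) * exp (- 1 / 2)"
    have m: "m > 0" by (simp add: m_def)
    \<comment> \<open>Here \<open>B * K\<close> bounds the limit of the pairings, \<open>m\<close>
      bounds the Gaussian from below near its centre, and \<open>exp 1\<close> arises from
      \<open>exp (- (u + 1)) = 1 / (N * exp 1)\<close>.\<close>
    have "s N / real N \<le> exp 1 * B * K / m" if N: "N \<ge> 1" for N
    proof -
      define u where "u = ln (real N)"
      define \<phi> where "\<phi> = (\<lambda>y. exp (\<i> * complex_of_real u * of_real y - (of_real y)\<^sup>2 / 2))"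
      have \<phi>: "schwartz \<phi>" unfolding \<phi>_def by (rule schwartz_gaussian) simp
      have ft: "fourier_transform \<phi> = (\<lambda>t. complex_of_real (k (t - u)))"
        unfolding \<phi>_def k_def by (rule ext) (rule fourier_transform_gaussian)
      have k_shift: "integrable lborel (\<lambda>t. k (t - u))" "(\<integral>t. k (t - u) \<partial>lborel) = K"
        using lborel_integrable_real_affine[OF k_int, of 1 "- u"]
          lborel_integral_real_affine[of 1 k "- u"] by (simp_all add: K_def)
      \<comment> \<open>Translating the Gaussian does not change its integral, so this bound does
        not depend on \<open>u\<close> and hence not on \<open>N\<close>.\<close>
      have up: "cmod (T \<phi>) \<le> B * K"
      proof -
        have [measurable]: "(\<lambda>t. k (t - u)) \<in> borel_measurable borel"
          using borel_measurable_integrable[OF k_shift(1)] by simp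
        have "cmod (T \<phi>) \<le> B * (\<integral>t. cmod (fourier_transform \<phi> t) \<partial>lebesgue)"
          unfolding TH[OF \<phi>] distribution_fourier_def distribution_of_fun_def
          by (rule cmod_integral_bounded_mult_le[OF _ B])
             (simp add: ft integrable_completion k_shift(1))
        also have "(\<integral>t. cmod (fourier_transform \<phi> t) \<partial>lebesgue) = (\<integral>t. k (t - u) \<partial>lborel)"
          by (simp add: ft integral_completion) (simp add: k_def)
        finally show ?thesis by (simp add: k_shift)
      qed
      have low: "s N * exp (- (x * (u + 1))) * m \<le> cmod (distribution_of_fun (\<lambda>y. q (Complex x y)) \<phi>)"
        if x: "x > 1" for x
      proof -
        define g where "g t = summatory a t * exp (- (x * t)) * k (t - u)" for t
        have g0: "g t \<ge> 0" for t
          using summatory_nonneg[of a t] a_nonneg by (simp add: g_def k_def)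
        \<comment> \<open>The interval is open on the left because the coefficient at
          \<open>N\<close> is counted only for \<open>t > ln N\<close>. On it each of the three
          factors of \<open>g\<close> is at least the corresponding constant.\<close>
        have g_lower: "s N * exp (- (x * (u + 1))) * m * indicator {u<..u + 1} t \<le> g t" for t
        proof (cases "t \<in> {u<..u + 1}")
          case True
          have "s N \<le> summatory a t"
            using sum_le_summatory[of a N t] a_nonneg True s[OF N] by (simp add: u_def)
          moreover have "s N \<ge> 0"
            unfolding s[OF N] by (rule sum_nonneg) (use a_nonneg in auto)
          moreover have "exp (- (x * (u + 1))) \<le> exp (- (x * t))"
            using True x by simp
          moreover have "m \<le> k (t - u)"
          proof -
            have "(t - u)\<^sup>2 \<le> 1\<^sup>2" using True by (intro power_mono) auto
            then show ?thesis by (simp add: m_def k_def)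
          qed
          ultimately have "s N * exp (- (x * (u + 1))) * m \<le> summatory a t * exp (- (x * t)) * k (t - u)"
            using m by (intro mult_mono) auto
          then show ?thesis using True by (simp add: g_def)
        qed (use g0 in simp)
        have kb: "k t \<le> sqrt (2 * pi)" "k t \<ge> 0" for t by (simp_all add: k_def)
        have g_int: "integrable lborel g"
        proof (rule Bochner_Integration.integrable_bound)
          show "integrable lborel (\<lambda>t. sqrt (2 * pi) * cmod (G x t))"
            using G_int[OF x] by simp
          show "g \<in> borel_measurable lborel"
          proof -
            have "(\<lambda>t. Re (G x t) * k (t - u)) \<in> borel_measurable lborel"
              using borel_measurable_integrable[OF G_int[OF x]] borel_measurable_integrable[OF k_shift(1)]
              by measurable
            then show ?thesis by (simp add: g_def[abs_def] G_def)
          qed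
          show "AE t in lborel. norm (g t) \<le> norm (sqrt (2 * pi) * cmod (G x t))"
          proof (rule AE_I2)
            fix t
            have "g t = k (t - u) * cmod (G x t)" by (simp add: g_def G_norm)
            also have "\<dots> \<le> sqrt (2 * pi) * cmod (G x t)"
              using kb by (intro mult_right_mono) auto
            finally show "norm (g t) \<le> norm (sqrt (2 * pi) * cmod (G x t))"
              using g0[of t] by simp
          qed
        qed
        have "s N * exp (- (x * (u + 1))) * m
            = (\<integral>t. s N * exp (- (x * (u + 1))) * m * indicator {u<..u + 1} t \<partial>lborel)"
          by simp
        also have "\<dots> \<le> (\<integral>t. g t \<partial>lborel)"
          using g_lower by (intro integral_mono g_int integrable_mult_right integrable_real_indicator) auto
        also have "\<dots> \<le> cmod (of_real (\<integral>t. g t \<partial>lborel))" by simp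
        \<comment> \<open>Both \<open>G x\<close> and the transform of \<open>\<phi>\<close> have
          nonnegative real values, so the pairing is itself the integral of \<open>g\<close> and
          taking its modulus loses nothing.\<close>
        also have "of_real (\<integral>t. g t \<partial>lborel) = distribution_of_fun (\<lambda>y. q (Complex x y)) \<phi>"
          unfolding qT[OF x \<phi>] by (simp add: ft g_def G_def flip: integral_complex_of_real of_real_mult)
        finally show ?thesis .
      qed
      \<comment> \<open>For fixed \<open>N\<close> both sides of the lower bound converge as
        \<open>x\<close> decreases to 1, so it passes to the limit \<open>T \<phi>\<close>.\<close>
      have "s N * exp (- (1 * (u + 1))) * m \<le> cmod (T \<phi>)"
      proof (rule tendsto_le)
        show "((\<lambda>x. cmod (distribution_of_fun (\<lambda>y. q (Complex x y)) \<phi>)) \<longlongrightarrow> cmod (T \<phi>)) (at_right 1)"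
          by (intro tendsto_norm lim \<phi>)
        show "((\<lambda>x. s N * exp (- (x * (u + 1))) * m) \<longlongrightarrow> s N * exp (- (1 * (u + 1))) * m) (at_right 1)"
          by (intro tendsto_intros)
        show "\<forall>\<^sub>F x in at_right 1. s N * exp (- (x * (u + 1))) * m
            \<le> cmod (distribution_of_fun (\<lambda>y. q (Complex x y)) \<phi>)"
          by (rule eventually_mono[OF eventually_at_right_less low])
      qed simp
      also note up
      finally have "s N * exp (- (u + 1)) * m \<le> B * K" by simp
      moreover have "exp (- (u + 1)) = 1 / (real N * exp 1)"
        using N by (simp add: u_def exp_minus exp_add exp_diff divide_inverse)
      ultimately have "s N * (1 / (real N * exp 1)) * m \<le> B * K" by (simp only:)
      then show ?thesis
        using m N by (simp add: field_simps)
    qed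
    moreover have "s N / real N \<ge> 0" if "N \<ge> 1" for N
      unfolding s[OF that] by (intro divide_nonneg_nonneg sum_nonneg) (use a_nonneg in auto)
    ultimately have "norm (s N / real N) \<le> exp 1 * B * K / m" if "N \<ge> 1" for N
      using that by (simp only: real_norm_def abs_of_nonneg)
    then show "bounded ((\<lambda>N. s N / real N) ` {1..})"
      by (intro boundedI[of _ "exp 1 * B * K / m"]) (auto simp del: real_norm_def)
  qed
qed

end
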